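(* Let $\Bbbk$ be a field of characteristic $0$ and let $\mathfrak{g}$ be an infinite-dimensional Lie subalgebra of $W_{\geq -1} = \operatorname{Der}(\Bbbk[t])$ which satisfies condition $( * )$: there exists $q \in U(\mathfrak{g})$ with $\Phi(q) \in \Bbbk[y,t,t^{-1}] \setminus \Bbbk[y]$. Then $U(\mathfrak{g})$ is not noetherian.
   Context: $W_{\geq -1} = \operatorname{Der}(\Bbbk[t]) = \Bbbk[t]\partial$, where $\partial$ is differentiation with respect to $t$, with Lie bracket $[f\partial, g\partial] = (fg' - f'g)\partial$; it has basis $e_n = t^{n+1}\partial$, $n \geq -1$, with $[e_n,e_m] = (m-n)e_{n+m}$. Let $\sigma$ be the automorphism of $\Bbbk[x,y]$ given by $f^\sigma(x,y) = f(x+1,y)$, and let $T = \Bbbk[x,y][t^{\pm 1};\sigma] = \bigoplus_{n\in\mathbb{Z}} \Bbbk[x,y]t^n$ be the skew Laurent polynomial ring with multiplication determined by $t f(x,y) = f(x+1,y) t$. The subalgebra of $T$ generated by $y,t,t^{-1}$ is the commutative ring $\Bbbk[y,t,t^{-1}]$. The linear map $W_{\geq -1} \to T$, $e_n \mapsto -(x+ny)t^n$, is a Lie algebra homomorphism (with respect to the commutator on $T$) and hence induces a $\Bbbk$-algebra homomorphism $\Phi : U(W_{\geq -1}) \to T$. For a Lie subalgebra $\mathfrak{g} \subseteq W_{\geq -1}$, $U(\mathfrak{g})$ is regarded as a subalgebra of $U(W_{\geq -1})$. Noetherian means left and right noetherian (equivalent to each other for universal enveloping algebras). *)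

theory Defs
  imports
    "HOL-Algebra.QuotRing"
    "HOL-Library.Poly_Mapping"
    "HOL-Computational_Algebra.Polynomial"
begin

section \<open>One-sided ideals and noetherian rings\<close>

definition left_ideal :: "'a set \<Rightarrow> ('a, 'm) ring_scheme \<Rightarrow> bool" where
  "left_ideal I R \<longleftrightarrow> additive_subgroup I R \<and> (\<forall>a\<in>I. \<forall>x\<in>carrier R. x \<otimes>\<^bsub>R\<^esub> a \<in> I)"

definition right_ideal :: "'a set \<Rightarrow> ('a, 'm) ring_scheme \<Rightarrow> bool" where
  "right_ideal I R \<longleftrightarrow> additive_subgroup I R \<and> (\<forall>a\<in>I. \<forall>x\<in>carrier R. a \<otimes>\<^bsub>R\<^esub> x \<in> I)"

text \<open>The library's \<^locale>\<open>ideal\<close> is two-sided; over a noncommutative ring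
  the noetherian condition concerns one-sided ideals.\<close>

definition left_noetherian :: "('a, 'm) ring_scheme \<Rightarrow> bool" where
  "left_noetherian R \<longleftrightarrow> (\<forall>I. left_ideal I R \<longrightarrow>
     (\<exists>A. finite A \<and> A \<subseteq> carrier R \<and> I = \<Inter>{J. left_ideal J R \<and> A \<subseteq> J}))"

definition right_noetherian :: "('a, 'm) ring_scheme \<Rightarrow> bool" where
  "right_noetherian R \<longleftrightarrow> (\<forall>I. right_ideal I R \<longrightarrow>
     (\<exists>A. finite A \<and> A \<subseteq> carrier R \<and> I = \<Inter>{J. right_ideal J R \<and> A \<subseteq> J}))"

definition noetherian :: "('a, 'm) ring_scheme \<Rightarrow> bool" where
  "noetherian R \<longleftrightarrow> left_noetherian R \<and> right_noetherian R"

section \<open>Free associative algebras\<close>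

text \<open>Words under concatenation, written additively so that the convolution product of
  \<^theory>\<open>HOL-Library.Poly_Mapping\<close> on finitely supported functions is the product of the
  free associative algebra.\<close>

datatype 'v free_word = Word (letters: "'v list")

instantiation free_word :: (type) monoid_add
begin

definition zero_free_word :: "'a free_word" where "0 = Word []"

definition plus_free_word :: "'a free_word \<Rightarrow> 'a free_word \<Rightarrow> 'a free_word" where
  "u + v = Word (letters u @ letters v)"

instance
  by standard (auto simp: zero_free_word_def plus_free_word_def)

end

definition class_ring :: "'a::ring_1 set \<Rightarrow> 'a ring" where
  "class_ring S = \<lparr>carrier = S, monoid.mult = (*), one = 1, zero = 0, add = (+)\<rparr>"

definition free_alg :: "'v set \<Rightarrow> ('v free_word \<Rightarrow>\<^sub>0 'k::comm_ring_1) ring" where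
  "free_alg X = class_ring {p. \<forall>w\<in>Poly_Mapping.keys p. set (letters w) \<subseteq> X}"

definition free_gen :: "'v \<Rightarrow> ('v free_word \<Rightarrow>\<^sub>0 'k::comm_ring_1)" where
  "free_gen v = Poly_Mapping.single (Word [v]) 1"

definition free_const :: "'k::comm_ring_1 \<Rightarrow> ('v free_word \<Rightarrow>\<^sub>0 'k)" where
  "free_const c = Poly_Mapping.single 0 c"

section \<open>Universal enveloping algebras\<close>

text \<open>The universal enveloping algebra of a Lie algebra \<open>L\<close> with scalar multiplication \<open>sc\<close> and
  bracket \<open>br\<close>: the quotient of the free algebra on the set \<open>L\<close> by the relations that make
  the generators depend linearly on \<open>L\<close> (so that the quotient by these alone is the tensor
  algebra) and the relations \<open>xy - yx = [x,y]\<close>.\<close>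

definition uea_rels ::
  "('k::field \<Rightarrow> 'v::ab_group_add \<Rightarrow> 'v) \<Rightarrow> ('v \<Rightarrow> 'v \<Rightarrow> 'v) \<Rightarrow> 'v set
     \<Rightarrow> ('v free_word \<Rightarrow>\<^sub>0 'k) set" where
  "uea_rels sc br L =
     {free_gen (x + y) - free_gen x - free_gen y | x y. x \<in> L \<and> y \<in> L} \<union>
     {free_gen (sc c x) - free_const c * free_gen x | c x. x \<in> L} \<union>
     {free_gen x * free_gen y - free_gen y * free_gen x - free_gen (br x y) | x y. x \<in> L \<and> y \<in> L}"

definition uea_ideal ::
  "('k::field \<Rightarrow> 'v::ab_group_add \<Rightarrow> 'v) \<Rightarrow> ('v \<Rightarrow> 'v \<Rightarrow> 'v) \<Rightarrow> 'v set
     \<Rightarrow> ('v free_word \<Rightarrow>\<^sub>0 'k) set" where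
  "uea_ideal sc br L = Idl\<^bsub>free_alg L\<^esub> (uea_rels sc br L)"

definition uea ::
  "('k::field \<Rightarrow> 'v::ab_group_add \<Rightarrow> 'v) \<Rightarrow> ('v \<Rightarrow> 'v \<Rightarrow> 'v) \<Rightarrow> 'v set
     \<Rightarrow> ('v free_word \<Rightarrow>\<^sub>0 'k) set ring" where
  "uea sc br L = free_alg L Quot (uea_ideal sc br L)"

definition uea_gen ::
  "('k::field \<Rightarrow> 'v::ab_group_add \<Rightarrow> 'v) \<Rightarrow> ('v \<Rightarrow> 'v \<Rightarrow> 'v) \<Rightarrow> 'v set
     \<Rightarrow> 'v \<Rightarrow> ('v free_word \<Rightarrow>\<^sub>0 'k) set" where
  "uea_gen sc br L x = uea_ideal sc br L +>\<^bsub>free_alg L\<^esub> free_gen x"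

text \<open>For \<open>L \<subseteq> M\<close>, the canonical map from the enveloping algebra of \<open>L\<close> to that of \<open>M\<close> sends a
  coset modulo the smaller ideal to the coset modulo the larger ideal containing it.\<close>

definition uea_incl ::
  "('k::field \<Rightarrow> 'v::ab_group_add \<Rightarrow> 'v) \<Rightarrow> ('v \<Rightarrow> 'v \<Rightarrow> 'v) \<Rightarrow> 'v set
     \<Rightarrow> ('v free_word \<Rightarrow>\<^sub>0 'k) set \<Rightarrow> ('v free_word \<Rightarrow>\<^sub>0 'k) set" where
  "uea_incl sc br M q = uea_ideal sc br M <+>\<^bsub>free_alg M\<^esub> q"

text \<open>The homomorphism to a \<open>\<bbbk>\<close>-algebra with structure map \<open>s\<close> determined by the images \<open>\<phi>\<close> of
  the generators, first on the free algebra and then on cosets.\<close>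

definition free_eval ::
  "('k::comm_ring_1 \<Rightarrow> 'a::ring_1) \<Rightarrow> ('v \<Rightarrow> 'a) \<Rightarrow> ('v free_word \<Rightarrow>\<^sub>0 'k) \<Rightarrow> 'a" where
  "free_eval s \<phi> p =
     (\<Sum>w\<in>Poly_Mapping.keys p. s (Poly_Mapping.lookup p w) * prod_list (map \<phi> (letters w)))"

definition uea_lift ::
  "('k::comm_ring_1 \<Rightarrow> 'a::ring_1) \<Rightarrow> ('v \<Rightarrow> 'a) \<Rightarrow> ('v free_word \<Rightarrow>\<^sub>0 'k) set \<Rightarrow> 'a" where
  "uea_lift s \<phi> q = the_elem (free_eval s \<phi> ` q)"

section \<open>The Lie algebra of derivations of \<open>\<bbbk>[t]\<close>\<close>

text \<open>The vector field \<open>f \<partial>\<close> is represented by the polynomial \<open>f\<close>.\<close>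

definition witt_bracket :: "'k::field poly \<Rightarrow> 'k poly \<Rightarrow> 'k poly" where
  "witt_bracket f g = f * pderiv g - pderiv f * g"

definition witt_der :: "'k::field poly \<Rightarrow> 'k poly \<Rightarrow> 'k poly" where
  "witt_der f h = f * pderiv h"

definition derivations :: "('k::field poly \<Rightarrow> 'k poly) set" where
  "derivations = {D. (\<forall>a b. D (a + b) = D a + D b) \<and> (\<forall>c a. D (smult c a) = smult c (D a)) \<and>
     (\<forall>a b. D (a * b) = D a * b + a * D b)}"

definition lie_subalgebra :: "'k::field poly set \<Rightarrow> bool" where
  "lie_subalgebra \<gg> \<longleftrightarrow> module.subspace smult \<gg> \<and> (\<forall>f\<in>\<gg>. \<forall>g\<in>\<gg>. witt_bracket f g \<in> \<gg>)"

definition infinite_dimensional :: "'k::field poly set \<Rightarrow> bool" where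
  "infinite_dimensional V \<longleftrightarrow> \<not> (\<exists>B. finite B \<and> V \<subseteq> module.span smult B)"

abbreviation U_witt :: "'k::field poly set \<Rightarrow> ('k poly free_word \<Rightarrow>\<^sub>0 'k) set ring" where
  "U_witt \<gg> \<equiv> uea smult witt_bracket \<gg>"

section \<open>The skew Laurent polynomial ring\<close>

text \<open>\<open>\<bbbk>[x,y]\<close> is \<^typ>\<open>'k poly poly\<close>: polynomials in \<open>x\<close> with coefficients in \<open>\<bbbk>[y]\<close>.
  \<open>shift m\<close> is the \<open>m\<close>-th power of \<open>\<sigma>\<close>.\<close>

definition poly_x :: "'k::field poly poly" where "poly_x = [:0, 1:]"
definition poly_y :: "'k::field poly poly" where "poly_y = [:[:0, 1:]:]"

definition shift :: "int \<Rightarrow> 'k::field poly poly \<Rightarrow> 'k poly poly" where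
  "shift m f = pcompose f [:of_int m, 1:]"

text \<open>The value of \<open>skew_coeff f\<close> at \<open>n\<close> is the coefficient, written on the left, of \<open>t\<^sup>n\<close> in \<open>f\<close>.\<close>

typedef (overloaded) 'k skew_laurent = "UNIV :: (int \<Rightarrow>\<^sub>0 'k::field poly poly) set"
  morphisms skew_coeff Abs_skew ..

lifting_forget poly.lifting
lifting_forget poly_mapping.lifting
setup_lifting type_definition_skew_laurent

lift_definition skew_monom :: "'k::field poly poly \<Rightarrow> int \<Rightarrow> 'k skew_laurent"
  is "\<lambda>a n. Poly_Mapping.single n a" .

lemma shift_0: "shift m 0 = 0"
  and shift_add: "shift m (a + b) = shift m a + shift m b"
  and shift_mult: "shift m (a * b) = shift m a * shift m b"
  and shift_1: "shift m 1 = 1"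
  and shift_zero_left: "shift 0 a = a"
  by (simp_all add: shift_def pcompose_add pcompose_mult pcompose_1 pcompose_idR)

lemma shift_shift: "shift m (shift n a) = shift (m + n) a"
proof -
  have "pcompose [:of_int n, 1:] [:of_int m, 1:] = ([:of_int (m + n), 1:] :: 'a poly poly)"
    by (simp add: pcompose_pCons algebra_simps)
  then show ?thesis by (simp add: shift_def flip: pcompose_assoc)
qed

definition skew_mult ::
  "(int \<Rightarrow>\<^sub>0 'k::field poly poly) \<Rightarrow> (int \<Rightarrow>\<^sub>0 'k poly poly) \<Rightarrow> (int \<Rightarrow>\<^sub>0 'k poly poly)" where
  "skew_mult f g = (\<Sum>m\<in>Poly_Mapping.keys f. \<Sum>n\<in>Poly_Mapping.keys g.
     Poly_Mapping.single (m + n) (Poly_Mapping.lookup f m * shift m (Poly_Mapping.lookup g n)))"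

lemma skew_mult_superset:
  assumes "finite A" "Poly_Mapping.keys f \<subseteq> A" "finite B" "Poly_Mapping.keys g \<subseteq> B"
  shows "skew_mult f g = (\<Sum>m\<in>A. \<Sum>n\<in>B.
     Poly_Mapping.single (m + n) (Poly_Mapping.lookup f m * shift m (Poly_Mapping.lookup g n)))"
proof -
  have "skew_mult f g = (\<Sum>m\<in>Poly_Mapping.keys f. \<Sum>n\<in>B.
     Poly_Mapping.single (m + n) (Poly_Mapping.lookup f m * shift m (Poly_Mapping.lookup g n)))"
    unfolding skew_mult_def
    by (intro sum.cong refl sum.mono_neutral_left) (use assms in \<open>auto simp: shift_0 in_keys_iff\<close>)
  also have "\<dots> = (\<Sum>m\<in>A. \<Sum>n\<in>B.
     Poly_Mapping.single (m + n) (Poly_Mapping.lookup f m * shift m (Poly_Mapping.lookup g n)))"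
    by (intro sum.mono_neutral_left) (use assms in \<open>auto simp: in_keys_iff\<close>)
  finally show ?thesis .
qed

lemma skew_mult_add_left: "skew_mult (f + g) h = skew_mult f h + skew_mult g h"
proof -
  let ?A = "Poly_Mapping.keys f \<union> Poly_Mapping.keys g" and ?B = "Poly_Mapping.keys h"
  have "Poly_Mapping.keys (f + g) \<subseteq> ?A" by (rule Poly_Mapping.keys_add)
  then show ?thesis
    by (subst (1 2 3) skew_mult_superset[of ?A _ ?B])
       (auto simp: lookup_add single_add distrib_right sum.distrib)
qed

lemma skew_mult_add_right: "skew_mult h (f + g) = skew_mult h f + skew_mult h g"
proof -
  let ?B = "Poly_Mapping.keys f \<union> Poly_Mapping.keys g" and ?A = "Poly_Mapping.keys h"
  have "Poly_Mapping.keys (f + g) \<subseteq> ?B" by (rule Poly_Mapping.keys_add)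
  then show ?thesis
    by (subst (1 2 3) skew_mult_superset[of ?A _ ?B])
       (auto simp: lookup_add single_add distrib_left sum.distrib shift_add)
qed

lemma skew_mult_single:
  "skew_mult (Poly_Mapping.single m a) (Poly_Mapping.single n b) =
     Poly_Mapping.single (m + n) (a * shift m b)"
  by (subst skew_mult_superset[of "{m}" _ "{n}"]) auto

lemma single_add_induct:
  assumes "\<And>n a. P (Poly_Mapping.single n a)" "\<And>f g. P f \<Longrightarrow> P g \<Longrightarrow> P (f + g)"
  shows "P (f :: 'i \<Rightarrow>\<^sub>0 'b::comm_monoid_add)"
proof (induction f rule: update_induct)
  case const
  show ?case using assms(1)[of undefined 0] by simp
next
  case (update f a b)
  have "Poly_Mapping.update a b f = Poly_Mapping.single a b + f"
    using update(1) by (intro poly_mapping_eqI)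
      (auto simp: lookup_update lookup_add lookup_single in_keys_iff when_def)
  then show ?case using assms update by metis
qed

instantiation skew_laurent :: (field) ring_1
begin

lift_definition zero_skew_laurent :: "'a skew_laurent" is 0 .
lift_definition one_skew_laurent :: "'a skew_laurent" is "Poly_Mapping.single 0 1" .
lift_definition plus_skew_laurent :: "'a skew_laurent \<Rightarrow> 'a skew_laurent \<Rightarrow> 'a skew_laurent" is "(+)" .
lift_definition minus_skew_laurent :: "'a skew_laurent \<Rightarrow> 'a skew_laurent \<Rightarrow> 'a skew_laurent" is "(-)" .
lift_definition uminus_skew_laurent :: "'a skew_laurent \<Rightarrow> 'a skew_laurent" is uminus .
lift_definition times_skew_laurent :: "'a skew_laurent \<Rightarrow> 'a skew_laurent \<Rightarrow> 'a skew_laurent"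
  is skew_mult .

instance
proof
  fix a b c :: "'a skew_laurent"
  show "a * b * c = a * (b * c)"
  proof transfer
    fix a b c :: "int \<Rightarrow>\<^sub>0 'a poly poly"
    show "skew_mult (skew_mult a b) c = skew_mult a (skew_mult b c)"
    proof (induction a rule: single_add_induct)
      case (1 m u)
      show ?case
      proof (induction b rule: single_add_induct)
        case (1 n v)
        show ?case
        proof (induction c rule: single_add_induct)
          case (1 l w)
          show ?case
            by (simp add: skew_mult_single shift_mult shift_shift ac_simps)
        qed (simp add: skew_mult_add_right)
      qed (simp add: skew_mult_add_right skew_mult_add_left)
    qed (simp add: skew_mult_add_left)
  qed
  show "1 * a = a"
  proof transfer
    fix a :: "int \<Rightarrow>\<^sub>0 'a poly poly"
    show "skew_mult (Poly_Mapping.single 0 1) a = a"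
      by (induction a rule: single_add_induct)
         (simp_all only: skew_mult_single skew_mult_add_right shift_zero_left add_0 mult_1)
  qed
  show "a * 1 = a"
  proof transfer
    fix a :: "int \<Rightarrow>\<^sub>0 'a poly poly"
    show "skew_mult a (Poly_Mapping.single 0 1) = a"
      by (induction a rule: single_add_induct)
         (simp_all only: skew_mult_single skew_mult_add_left shift_1 add_0_right mult_1_right)
  qed
  show "(0 :: 'a skew_laurent) \<noteq> 1"
    by transfer (metis lookup_single_eq lookup_zero zero_neq_one)
qed (transfer; simp add: skew_mult_add_left skew_mult_add_right algebra_simps)+

end

definition skew_const :: "'k::field \<Rightarrow> 'k skew_laurent" where
  "skew_const c = skew_monom [:[:c:]:] 0"

definition skew_t :: "int \<Rightarrow> 'k::field skew_laurent" where
  "skew_t n = skew_monom 1 n"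

text \<open>The unital \<open>\<bbbk>\<close>-subalgebra generated by a set.\<close>

inductive_set subalgebra_gen :: "'k::field skew_laurent set \<Rightarrow> 'k skew_laurent set" for S where
  const: "skew_const c \<in> subalgebra_gen S"
| incl: "a \<in> S \<Longrightarrow> a \<in> subalgebra_gen S"
| add: "a \<in> subalgebra_gen S \<Longrightarrow> b \<in> subalgebra_gen S \<Longrightarrow> a + b \<in> subalgebra_gen S"
| mult: "a \<in> subalgebra_gen S \<Longrightarrow> b \<in> subalgebra_gen S \<Longrightarrow> a * b \<in> subalgebra_gen S"

text \<open>\<open>\<bbbk>[y,t,t\<^sup>-\<^sup>1]\<close> and \<open>\<bbbk>[y]\<close> as subalgebras of the skew Laurent ring.\<close>

definition k_ytt :: "'k::field skew_laurent set" where
  "k_ytt = subalgebra_gen {skew_monom poly_y 0, skew_t 1, skew_t (-1)}"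

definition k_y :: "'k::field skew_laurent set" where
  "k_y = subalgebra_gen {skew_monom poly_y 0}"

section \<open>The homomorphism \<open>\<Phi>\<close>\<close>

text \<open>The linear map with \<open>e\<^sub>n = t\<^sup>n\<^sup>+\<^sup>1 \<partial> \<mapsto> -(x + n y) t\<^sup>n\<close>; the monomial \<open>t\<^sup>i\<close> of \<open>f\<close> stands
  for \<open>e\<^sub>i\<^sub>-\<^sub>1\<close>.\<close>

definition witt_map :: "'k::field poly \<Rightarrow> 'k skew_laurent" where
  "witt_map f = (\<Sum>i\<le>degree f. skew_const (coeff f i) *
     skew_monom (- (poly_x + of_int (int i - 1) * poly_y)) (int i - 1))"

definition \<Phi> :: "('k::field poly free_word \<Rightarrow>\<^sub>0 'k) set \<Rightarrow> 'k skew_laurent" where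
  "\<Phi> = uea_lift skew_const witt_map"

text \<open>The inclusion of \<open>U_witt \<gg>\<close> in \<open>U_witt UNIV\<close>, the enveloping algebra of the full Lie algebra.\<close>

definition U_incl :: "('k::field poly free_word \<Rightarrow>\<^sub>0 'k) set \<Rightarrow> ('k poly free_word \<Rightarrow>\<^sub>0 'k) set" where
  "U_incl = uea_incl smult witt_bracket UNIV"

definition condition_star :: "'k::field poly set \<Rightarrow> bool" where
  "condition_star \<gg> \<longleftrightarrow> (\<exists>q\<in>carrier (U_witt \<gg>). \<Phi> (U_incl q) \<in> k_ytt - k_y)"

section \<open>Basic properties of the definitions\<close>

subsection \<open>Derivations\<close>

interpretation poly_vs: vector_space "smult :: 'k::field \<Rightarrow> 'k poly \<Rightarrow> 'k poly"
  by standard (simp_all add: smult_add_right smult_add_left)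

lemma bij_betw_witt_der: "bij_betw witt_der (UNIV :: 'k::field poly set) derivations"
proof (rule bij_betw_imageI)
  show "inj (witt_der :: 'k poly \<Rightarrow> _)"
  proof (rule injI)
    fix f g :: "'k poly" assume "witt_der f = witt_der g"
    then have "witt_der f [:0,1:] = witt_der g [:0,1:]" by simp
    then show "f = g" by (simp add: witt_der_def pderiv_pCons)
  qed
  show "witt_der ` (UNIV :: 'k poly set) = derivations"
  proof (rule Set.set_eqI, rule iffI)
    fix D :: "'k poly \<Rightarrow> 'k poly" assume "D \<in> witt_der ` UNIV"
    then show "D \<in> derivations"
      by (auto simp: derivations_def witt_der_def pderiv_add pderiv_smult pderiv_mult algebra_simps)
  next
    fix D :: "'k poly \<Rightarrow> 'k poly" assume D: "D \<in> derivations"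
    have add: "D (a + b) = D a + D b" and sc: "D (smult c a) = smult c (D a)"
      and prod: "D (a * b) = D a * b + a * D b" for a b c
      using D by (auto simp: derivations_def)
    have "D 1 = D 1 + D 1" using prod[of 1 1] by (simp only: mult_1 mult_1_right)
    then have one: "D 1 = 0" by (metis add_cancel_right_right)
    have "D 0 = D 0 + D 0" using add[of 0 0] by (simp only: add_0)
    then have zero: "D 0 = 0" by (metis add_cancel_right_right)
    have "D h = witt_der (D [:0,1:]) h" for h
    proof (induction h)
      case 0
      then show ?case by (simp add: zero witt_der_def)
    next
      case (pCons a p)
      have "pCons a p = smult a 1 + [:0,1:] * p" by simp
      then have "D (pCons a p) = D (smult a 1) + D ([:0,1:] * p)" by (metis add)
      also have "\<dots> = D [:0,1:] * p + [:0,1:] * D p" by (simp only: sc one prod smult_0_right add_0)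
      also have "\<dots> = witt_der (D [:0,1:]) (pCons a p)"
        by (simp add: pCons.IH witt_der_def pderiv_pCons algebra_simps)
      finally show ?case .
    qed
    then show "D \<in> witt_der ` UNIV" by blast
  qed
qed

lemma witt_der_bracket:
  "witt_der (witt_bracket f g) h = witt_der f (witt_der g h) - witt_der g (witt_der f h)"
  by (simp add: witt_der_def witt_bracket_def pderiv_mult algebra_simps)

lemma witt_bracket_basis:
  "witt_bracket (monom 1 (Suc n)) (monom 1 (Suc m)) =
     smult (of_int (int m - int n)) (monom (1::'k::field) (Suc (n + m)))"
  by (simp add: witt_bracket_def pderiv_monom mult_monom smult_monom algebra_simps flip: add_monom diff_monom)

subsection \<open>The skew Laurent ring and the linear map\<close>

lemma skew_monom_mult: "skew_monom a m * skew_monom b n = skew_monom (a * shift m b) (m + n)"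
  by transfer (rule skew_mult_single)

lemma skew_monom_add: "skew_monom a m + skew_monom b m = skew_monom (a + b) m"
  by transfer (simp add: single_add)

lemma skew_t_commute: "skew_t 1 * skew_monom f 0 = skew_monom (shift 1 f) 0 * skew_t 1"
  by (simp add: skew_t_def skew_monom_mult shift_1)


lemma shift_x: "shift m poly_x = poly_x + of_int m" and shift_y: "shift m poly_y = poly_y"
  by (simp_all add: shift_def poly_x_def poly_y_def pcompose_pCons of_int_poly)

lemma shift_const: "shift m [:a:] = [:a:]"
  by (simp add: shift_def)

lemma skew_const_add: "skew_const (a + b) = skew_const a + skew_const b"
  by (simp add: skew_const_def skew_monom_add)
lemma skew_const_mult: "skew_const (a * b) = skew_const a * skew_const b"
  by (simp add: skew_const_def skew_monom_mult shift_const ac_simps)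
lemma skew_const_1: "skew_const 1 = 1"
  unfolding skew_const_def by transfer (simp add: one_pCons)
lemma skew_const_0: "skew_const 0 = 0"
  unfolding skew_const_def by transfer simp

lemma skew_induct:
  assumes "\<And>n a. P (skew_monom a n)" "\<And>f g. P f \<Longrightarrow> P g \<Longrightarrow> P (f + g)"
  shows "P f"
proof -
  have "P (Abs_skew p)" for p
  proof (induction p rule: single_add_induct)
    case (1 n a)
    then show ?case using assms(1)[of a n] by (simp add: skew_monom.abs_eq)
  next
    case (2 f g)
    then show ?case using assms(2) by (metis plus_skew_laurent.abs_eq)
  qed
  then show ?thesis by (metis skew_coeff_inverse)
qed

lemma skew_const_central: "skew_const c * f = f * skew_const c"
proof (induction f rule: skew_induct)
  case (1 n a)
  show ?case by (simp add: skew_const_def skew_monom_mult shift_const shift_zero_left mult.commute)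
qed (simp add: distrib_left distrib_right)

lemma witt_map_eq:
  assumes "degree f \<le> N"
  shows "witt_map f = (\<Sum>i\<le>N. skew_const (coeff f i) *
     skew_monom (- (poly_x + of_int (int i - 1) * poly_y)) (int i - 1))"
  unfolding witt_map_def
  by (rule sum.mono_neutral_left) (use assms in \<open>auto simp: coeff_eq_0 skew_const_0\<close>)

lemma witt_map_add: "witt_map (f + g) = witt_map f + witt_map g"
proof -
  let ?N = "max (degree f) (degree g)"
  show ?thesis
    by (subst (1 2 3) witt_map_eq[of _ ?N])
       (auto simp: degree_add_le_max skew_const_add distrib_right sum.distrib)
qed

lemma witt_map_smult: "witt_map (smult c f) = skew_const c * witt_map f"
  by (subst (1 2) witt_map_eq[of _ "degree f"])
     (auto simp: degree_smult_le skew_const_mult sum_distrib_left mult.assoc)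

lemma witt_map_monom:
  "witt_map (monom c i) = skew_const c *
     skew_monom (- (poly_x + of_int (int i - 1) * poly_y)) (int i - 1)"
proof -
  have "witt_map (monom c i) = (\<Sum>j\<le>i. if j = i then skew_const c *
     skew_monom (- (poly_x + of_int (int i - 1) * poly_y)) (int i - 1) else 0)"
    unfolding witt_map_eq[OF degree_monom_le] by (intro sum.cong refl) (simp add: skew_const_0)
  then show ?thesis by (simp del: of_int_diff)
qed

text \<open>\<open>e\<^sub>n \<mapsto> -(x + n y) t\<^sup>n\<close>\<close>
lemma witt_map_e:
  assumes "n \<ge> -1"
  shows "witt_map (monom 1 (nat (n + 1))) = - (skew_monom (poly_x + of_int n * poly_y) 0 * skew_t n)"
proof -
  have "- skew_monom a m = skew_monom (- a) m" for a :: "'a poly poly" and m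
    by transfer (simp add: single_uminus)
  then show ?thesis using assms
    by (simp add: witt_map_monom skew_const_1 skew_t_def skew_monom_mult shift_zero_left shift_1)
qed

lemma poly_add_induct:
  assumes "\<And>c i. P (monom c i)" "\<And>f g. P f \<Longrightarrow> P g \<Longrightarrow> P (f + g)"
  shows "P p"
proof -
  have "P (\<Sum>i\<in>A. monom (coeff p i) i)" if "finite A" for A
    using that by induction (use assms assms(1)[of 0 0] in auto)
  from this[of "{..degree p}"] show ?thesis by (simp add: poly_as_sum_of_monoms)
qed

lemma witt_bracket_add: "witt_bracket (a + b) c = witt_bracket a c + witt_bracket b c"
  "witt_bracket c (a + b) = witt_bracket c a + witt_bracket c b"
  by (simp_all add: witt_bracket_def pderiv_add algebra_simps)

lemma skew_monom_diff: "skew_monom a m - skew_monom b m = skew_monom (a - b) m"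
  by transfer (simp add: single_diff)

lemma witt_map_bracket:
  "witt_map (witt_bracket f g) = witt_map f * witt_map g - witt_map g * witt_map f"
proof (induction f rule: poly_add_induct)
  case (1 c i)
  show ?case
  proof (induction g rule: poly_add_induct)
    case (1 d j)
    define E where "E = (\<lambda>i. skew_monom (- (poly_x + of_int (int i - 1) * poly_y)) (int i - 1) :: 'a skew_laurent)"
    have w: "witt_map (monom c i) = skew_const c * E i" for c i by (simp add: witt_map_monom E_def)
    have br: "witt_bracket (monom c i) (monom d j) = monom (c * d * of_int (int j - int i)) (i + j - 1)"
      by (cases i; cases j)
         (simp_all add: witt_bracket_def pderiv_monom mult_monom algebra_simps flip: add_monom diff_monom minus_monom)
    have E: "skew_const (of_int (int j - int i)) * E (i + j - 1) = E i * E j - E j * E i"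
    proof (cases "i + j = 0")
      case True then show ?thesis by (simp add: skew_const_0)
    next
      case False
      then have *: "int (i + j - 1) = int i + int j - 1" by linarith
      have c: "[:[:of_int m:]:] = (of_int m :: 'a poly poly)" for m
        by (simp add: of_int_poly)
      have n: "shift m (-a) = - shift m a" for m and a :: "'a poly poly"
        by (simp add: shift_def pcompose_uminus)
      have o: "shift m (of_int k) = (of_int k :: 'a poly poly)" for m k
        by (simp add: shift_def of_int_poly)
      show ?thesis
        unfolding E_def * skew_const_def skew_monom_mult c n shift_add shift_mult shift_x shift_y o
        by (simp add: skew_monom_diff algebra_simps)
    qed
    have s: "(skew_const c * E i) * (skew_const d * E j) = skew_const (c * d) * (E i * E j)" for c d i j
      by (metis skew_const_central skew_const_mult mult.assoc)
    have "witt_map (witt_bracket (monom c i) (monom d j)) = skew_const (c * d) * (E i * E j - E j * E i)"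
      unfolding br w skew_const_mult[of "c * d"] by (simp add: mult.assoc flip: E)
    also have "\<dots> = witt_map (monom c i) * witt_map (monom d j) - witt_map (monom d j) * witt_map (monom c i)"
      unfolding w s by (simp add: algebra_simps)
    finally show ?case .
  qed (simp add: witt_bracket_add witt_map_add algebra_simps)
qed (simp add: witt_bracket_add witt_map_add algebra_simps)


subsection \<open>Enveloping algebras and their universal property\<close>

lemma class_ring_simps [simp]:
  "carrier (class_ring S) = S" "monoid.mult (class_ring S) = (*)" "one (class_ring S) = 1"
  "zero (class_ring S) = 0" "add (class_ring S) = (+)"
  by (simp_all add: class_ring_def)

lemma ring_class_ring:
  assumes "1 \<in> S" "\<And>a b. a \<in> S \<Longrightarrow> b \<in> S \<Longrightarrow> a - b \<in> S" "\<And>a b. a \<in> S \<Longrightarrow> b \<in> S \<Longrightarrow> a * b \<in> S"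
  shows "ring (class_ring S)"
proof -
  have z: "0 \<in> S" using assms(2)[OF assms(1,1)] by simp
  have m: "- a \<in> S" if "a \<in> S" for a using assms(2)[OF z that] by simp
  have p: "a + b \<in> S" if "a \<in> S" "b \<in> S" for a b
    using assms(2)[OF that(1) m[OF that(2)]] by simp
  show ?thesis
  proof (intro ringI abelian_groupI monoidI)
    fix x assume "x \<in> carrier (class_ring S)"
    then show "\<exists>y\<in>carrier (class_ring S). y \<oplus>\<^bsub>class_ring S\<^esub> x = \<zero>\<^bsub>class_ring S\<^esub>"
      by (intro bexI[of _ "- x"]) (simp_all add: m)
  qed (simp_all add: assms z p algebra_simps)
qed

lemma free_alg_carrier: "p \<in> carrier (free_alg X) \<longleftrightarrow> (\<forall>w\<in>Poly_Mapping.keys p. set (letters w) \<subseteq> X)"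
  by (simp add: free_alg_def)

lemma ring_free_alg: "ring (free_alg X :: ('v free_word \<Rightarrow>\<^sub>0 'k::comm_ring_1) ring)"
  unfolding free_alg_def
proof (rule ring_class_ring, goal_cases)
  case 1
  show ?case by (simp add: zero_free_word_def)
next
  case (2 a b)
  have "Poly_Mapping.keys (a - b) \<subseteq> Poly_Mapping.keys a \<union> Poly_Mapping.keys b"
    by (auto simp: in_keys_iff lookup_minus)
  then show ?case using 2 by blast
next
  case (3 a b)
  have "Poly_Mapping.keys (a * b) \<subseteq> {u + v | u v. u \<in> Poly_Mapping.keys a \<and> v \<in> Poly_Mapping.keys b}"
    by (rule keys_mult)
  then show ?case using 3 by (force simp: plus_free_word_def)
qed

lemma free_gen_closed: "x \<in> X \<Longrightarrow> (free_gen x :: _ \<Rightarrow>\<^sub>0 'k::comm_ring_1) \<in> carrier (free_alg X)"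
  by (simp add: free_alg_carrier free_gen_def)

lemma free_const_closed: "free_const c \<in> carrier (free_alg X)"
  by (auto simp: free_alg_carrier free_const_def zero_free_word_def split: if_splits)

lemma free_alg_ops:
  "monoid.mult (free_alg X) = (*)" "one (free_alg X) = 1" "zero (free_alg X) = 0" "add (free_alg X) = (+)"
  by (simp_all add: free_alg_def)

lemma free_alg_minus: "a \<in> carrier (free_alg X) \<Longrightarrow> b \<in> carrier (free_alg X) \<Longrightarrow>
   a - b \<in> carrier (free_alg X)"
  by (simp add: free_alg_carrier) (metis (no_types, opaque_lifting) diff_zero in_keys_iff lookup_minus)

lemma free_alg_mult: "a \<in> carrier (free_alg X) \<Longrightarrow> b \<in> carrier (free_alg X) \<Longrightarrow>
   a * b \<in> carrier (free_alg X)"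
  using ring.ring_simprules(5)[OF ring_free_alg, of a X b] by (simp add: free_alg_ops)

text \<open>Only closure is needed here; the Lie algebra axioms themselves play no role.\<close>

definition is_lie where
  "is_lie sc br L \<longleftrightarrow> (\<forall>x\<in>L. \<forall>y\<in>L. x + y \<in> L \<and> br x y \<in> L) \<and> (\<forall>c. \<forall>x\<in>L. sc c x \<in> L)"

lemma uea_rels_subset: "is_lie sc br L \<Longrightarrow> uea_rels sc br L \<subseteq> carrier (free_alg L)"
  unfolding uea_rels_def is_lie_def
  by (auto intro!: free_alg_minus free_alg_mult free_gen_closed free_const_closed)

lemma ideal_uea: "is_lie sc br L \<Longrightarrow> ideal (uea_ideal sc br L) (free_alg L)"
  unfolding uea_ideal_def by (rule ring.genideal_ideal[OF ring_free_alg uea_rels_subset])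

lemma ring_uea: "is_lie sc br L \<Longrightarrow> ring (uea sc br L)"
  unfolding uea_def by (rule ideal.quotient_is_ring[OF ideal_uea])

lemma free_eval_superset:
  assumes "finite A" "Poly_Mapping.keys p \<subseteq> A" "s 0 = 0"
  shows "free_eval s \<phi> p = (\<Sum>w\<in>A. s (Poly_Mapping.lookup p w) * prod_list (map \<phi> (letters w)))"
  unfolding free_eval_def
  by (rule sum.mono_neutral_left) (use assms in \<open>auto simp: in_keys_iff\<close>)

locale alg_hom =
  fixes s :: "'k::field \<Rightarrow> 'a::ring_1" and \<phi> :: "'v::ab_group_add \<Rightarrow> 'a"
  assumes s0: "s 0 = 0" and s1: "s 1 = 1" and sadd: "s (a + b) = s a + s b" and smul: "s (a * b) = s a * s b"
    and scen: "s c * z = z * s c"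
begin

lemma add: "free_eval s \<phi> (p + q) = free_eval s \<phi> p + free_eval s \<phi> q"
proof -
  let ?A = "Poly_Mapping.keys p \<union> Poly_Mapping.keys q"
  have "Poly_Mapping.keys (p + q) \<subseteq> ?A" by (rule Poly_Mapping.keys_add)
  then show ?thesis
    by (subst (1 2 3) free_eval_superset[of ?A])
       (auto simp: lookup_add sadd distrib_right sum.distrib s0)
qed

lemma single: "free_eval s \<phi> (Poly_Mapping.single w c) = s c * prod_list (map \<phi> (letters w))"
  by (subst free_eval_superset[of "{w}"]) (auto simp: s0)

lemma mult: "free_eval s \<phi> (p * q) = free_eval s \<phi> p * free_eval s \<phi> q"
proof (induction p rule: single_add_induct)
  case (1 u a)
  show ?case
  proof (induction q rule: single_add_induct)
    case (1 v b)
    show ?case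
      by (simp add: mult_single single plus_free_word_def smul) (simp add: mult.assoc scen[of b] )
  qed (simp add: distrib_left add)
qed (simp add: distrib_right add)

lemma zero: "free_eval s \<phi> 0 = 0" by (simp add: free_eval_def)

lemma uminus: "free_eval s \<phi> (- p) = - free_eval s \<phi> p"
  using add[of p "- p"] zero by (simp add: eq_neg_iff_add_eq_0 add.commute)

lemma minus: "free_eval s \<phi> (p - q) = free_eval s \<phi> p - free_eval s \<phi> q"
  using add[of p "- q"] uminus[of q] by simp

lemma gen: "free_eval s \<phi> (free_gen x) = \<phi> x" by (simp add: free_gen_def single s1)
lemma const: "free_eval s \<phi> (free_const c) = s c"
  by (simp add: free_const_def single zero_free_word_def)

lemma ideal_ker: "ideal {p \<in> carrier (free_alg X). free_eval s \<phi> p = 0} (free_alg X)"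
proof -
  interpret F: ring "free_alg X :: ('v free_word \<Rightarrow>\<^sub>0 'k) ring" by (rule ring_free_alg)
  have inv: "\<ominus>\<^bsub>free_alg X\<^esub> a = - a" if "a \<in> carrier (free_alg X)" for a :: "'v free_word \<Rightarrow>\<^sub>0 'k"
  proof (rule F.minus_equality)
    show "- a \<in> carrier (free_alg X)" using free_alg_minus[OF F.zero_closed that] by (simp add: free_alg_ops)
  qed (use that in \<open>auto simp: free_alg_ops\<close>)
  show ?thesis
  proof (rule idealI[OF ring_free_alg])
    show "subgroup {p \<in> carrier (free_alg X). free_eval s \<phi> p = 0} (add_monoid (free_alg X))"
    proof (rule subgroup.intro, goal_cases)
      case 1 then show ?case by auto
    next
      case (2 x y) then show ?case using F.a_closed[of x y] by (simp add: free_alg_ops add)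
    next
      case 3 then show ?case using F.zero_closed by (simp add: free_alg_ops zero)
    next
      case (4 x) then show ?case unfolding a_inv_def[symmetric] using F.a_inv_closed[of x] inv[of x] by (simp add: uminus)
    qed
  next
    fix a x :: "'v free_word \<Rightarrow>\<^sub>0 'k" assume ax: "a \<in> {p \<in> carrier (free_alg X). free_eval s \<phi> p = 0}" "x \<in> carrier (free_alg X)"
    show "x \<otimes>\<^bsub>free_alg X\<^esub> a \<in> {p \<in> carrier (free_alg X). free_eval s \<phi> p = 0}"
      using ax F.m_closed[of x a] by (simp add: free_alg_ops mult)
    show "a \<otimes>\<^bsub>free_alg X\<^esub> x \<in> {p \<in> carrier (free_alg X). free_eval s \<phi> p = 0}"
      using ax F.m_closed[of a x] by (simp add: free_alg_ops mult)
  qed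
qed

context
  fixes sc br L
  assumes L: "is_lie sc br L"
    and lin: "\<And>x y. x \<in> L \<Longrightarrow> y \<in> L \<Longrightarrow> \<phi> (x + y) = \<phi> x + \<phi> y"
      "\<And>x c. x \<in> L \<Longrightarrow> \<phi> (sc c x) = s c * \<phi> x"
      "\<And>x y. x \<in> L \<Longrightarrow> y \<in> L \<Longrightarrow> \<phi> (br x y) = \<phi> x * \<phi> y - \<phi> y * \<phi> x"
begin

lemma kills: "p \<in> uea_ideal sc br L \<Longrightarrow> free_eval s \<phi> p = 0"
proof -
  have "free_eval s \<phi> p = 0" if "p \<in> uea_rels sc br L" for p
    using that by (auto simp: uea_rels_def minus mult gen const lin)
  then have "uea_rels sc br L \<subseteq> {p \<in> carrier (free_alg L). free_eval s \<phi> p = 0}"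
    using uea_rels_subset[OF L] by blast
  from ring.genideal_minimal[OF ring_free_alg ideal_ker this]
  show "p \<in> uea_ideal sc br L \<Longrightarrow> free_eval s \<phi> p = 0" by (auto simp: uea_ideal_def)
qed

lemma lift_coset:
  assumes "p \<in> carrier (free_alg L)"
  shows "uea_lift s \<phi> (uea_ideal sc br L +>\<^bsub>free_alg L\<^esub> p) = free_eval s \<phi> p"
proof -
  have "0 \<in> uea_ideal sc br L"
    using additive_subgroup.zero_closed[OF ideal.axioms(1)[OF ideal_uea[OF L]]] by (simp add: free_alg_ops)
  then have "free_eval s \<phi> ` (uea_ideal sc br L +>\<^bsub>free_alg L\<^esub> p) = {free_eval s \<phi> p}"
    by (force simp: a_r_coset_def' free_alg_ops add kills)
  then show ?thesis by (simp add: uea_lift_def)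
qed

lemma lift_hom: "uea_lift s \<phi> \<in> ring_hom (uea sc br L) (class_ring UNIV)"
proof -
  interpret I: ideal "uea_ideal sc br L" "free_alg L" by (rule ideal_uea[OF L])
  have ex: "\<exists>p\<in>carrier (free_alg L). x = uea_ideal sc br L +>\<^bsub>free_alg L\<^esub> p" if "x \<in> carrier (uea sc br L)" for x
    using that by (auto simp: uea_def FactRing_def A_RCOSETS_def')
  have u: "monoid.mult (uea sc br L) = rcoset_mult (free_alg L) (uea_ideal sc br L)"
    "add (uea sc br L) = set_add (free_alg L)" "one (uea sc br L) = uea_ideal sc br L +>\<^bsub>free_alg L\<^esub> 1"
    by (simp_all add: uea_def FactRing_def free_alg_ops)
  show ?thesis
  proof (rule ring_hom_memI)
    fix x y assume x: "x \<in> carrier (uea sc br L)" and y: "y \<in> carrier (uea sc br L)"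
    obtain p where p: "p \<in> carrier (free_alg L)" "x = uea_ideal sc br L +>\<^bsub>free_alg L\<^esub> p" using ex[OF x] by blast
    obtain q where q: "q \<in> carrier (free_alg L)" "y = uea_ideal sc br L +>\<^bsub>free_alg L\<^esub> q" using ex[OF y] by blast
    show "uea_lift s \<phi> (x \<otimes>\<^bsub>uea sc br L\<^esub> y) = uea_lift s \<phi> x \<otimes>\<^bsub>class_ring UNIV\<^esub> uea_lift s \<phi> y"
      unfolding u p(2) q(2) I.rcoset_mult_add[OF p(1) q(1)]
      using p(1) q(1) I.m_closed[OF p(1) q(1)] by (simp add: lift_coset free_alg_ops mult)
    show "uea_lift s \<phi> (x \<oplus>\<^bsub>uea sc br L\<^esub> y) = uea_lift s \<phi> x \<oplus>\<^bsub>class_ring UNIV\<^esub> uea_lift s \<phi> y"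
      unfolding u p(2) q(2) I.a_rcos_sum[OF p(1) q(1)]
      using p(1) q(1) I.a_closed[OF p(1) q(1)] by (simp add: lift_coset free_alg_ops add)
  next
    show "uea_lift s \<phi> \<one>\<^bsub>uea sc br L\<^esub> = \<one>\<^bsub>class_ring UNIV\<^esub>"
      unfolding u using I.one_closed lift_coset[of 1] const[of 1]
      by (simp add: free_alg_ops s1 free_const_def)
  qed simp
qed

end
end

subsection \<open>\<open>\<Phi>\<close> is a well-defined homomorphism with the prescribed values on generators\<close>

interpretation W: alg_hom skew_const witt_map
  by standard (rule skew_const_0 skew_const_1 skew_const_add skew_const_mult skew_const_central)+

lemma is_lie_UNIV: "is_lie smult witt_bracket UNIV"
  by (simp add: is_lie_def)

lemma \<Phi>_hom: "\<Phi> \<in> ring_hom (U_witt UNIV) (class_ring UNIV)"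
  unfolding \<Phi>_def by (rule W.lift_hom[OF is_lie_UNIV witt_map_add witt_map_smult witt_map_bracket])

lemma \<Phi>_gen: "\<Phi> (uea_gen smult witt_bracket UNIV f) = witt_map f"
  unfolding \<Phi>_def uea_gen_def
  by (subst W.lift_coset[OF is_lie_UNIV witt_map_add witt_map_smult witt_map_bracket])
     (simp_all add: free_gen_closed W.gen)

lemma free_alg_mono: "L \<subseteq> M \<Longrightarrow> carrier (free_alg L) \<subseteq> carrier (free_alg M)"
  unfolding free_alg_carrier subset_iff by blast

lemma uea_ideal_mono:
  assumes "is_lie sc br L" "is_lie sc br M" "L \<subseteq> M"
  shows "uea_ideal sc br L \<subseteq> uea_ideal (sc :: 'a::field \<Rightarrow> 'b::ab_group_add \<Rightarrow> 'b) br M"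
proof -
  interpret I: ideal "uea_ideal sc br M" "free_alg M" by (rule ideal_uea[OF assms(2)])
  interpret F: ring "free_alg L :: ('b free_word \<Rightarrow>\<^sub>0 'a) ring" by (rule ring_free_alg)
  have r: "uea_rels sc br L \<subseteq> uea_ideal sc br M \<inter> carrier (free_alg L)"
  proof -
    have "uea_rels sc br L \<subseteq> uea_rels sc br M"
      using assms(3) unfolding uea_rels_def by blast
    also have "\<dots> \<subseteq> uea_ideal sc br M"
      unfolding uea_ideal_def by (rule ring.genideal_self[OF ring_free_alg uea_rels_subset[OF assms(2)]])
    finally show ?thesis using uea_rels_subset[OF assms(1)] by blast
  qed
  have m: "x \<in> carrier (free_alg M)" if "x \<in> carrier (free_alg L)" for x :: "'b free_word \<Rightarrow>\<^sub>0 'a"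
    using free_alg_mono[OF assms(3)] that by blast
  have inv: "\<ominus>\<^bsub>free_alg N\<^esub> a = - a" if "a \<in> carrier (free_alg N)"
    for a :: "'b free_word \<Rightarrow>\<^sub>0 'a" and N :: "'b set"
  proof (rule abelian_group.minus_equality)
    show "abelian_group (free_alg N :: ('b free_word \<Rightarrow>\<^sub>0 'a) ring)"
      by (rule ring.is_abelian_group[OF ring_free_alg])
    show "- a \<in> carrier (free_alg N)"
      using free_alg_minus[OF _ that, of 0] by (simp add: free_alg_carrier)
  qed (use that in \<open>auto simp: free_alg_ops\<close>)
  have "ideal (uea_ideal sc br M \<inter> carrier (free_alg L)) (free_alg L)"
  proof (rule idealI[OF ring_free_alg])
    show "subgroup (uea_ideal sc br M \<inter> carrier (free_alg L)) (add_monoid (free_alg L))"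
    proof (rule subgroup.intro, goal_cases)
      case 1 then show ?case by auto
    next
      case (2 x y) then show ?case using F.a_closed[of x y] additive_subgroup.a_closed[OF I.additive_subgroup_axioms, of x y] by (simp add: free_alg_ops)
    next
      case 3 then show ?case using F.zero_closed additive_subgroup.zero_closed[OF I.additive_subgroup_axioms] by (simp add: free_alg_ops)
    next
      case (4 x)
      then show ?case unfolding a_inv_def[symmetric]
        using F.a_inv_closed[of x] subgroup.m_inv_closed[OF additive_subgroup.a_subgroup[OF I.additive_subgroup_axioms], of x, folded a_inv_def] inv[of x L] inv[of x M] m[of x] by simp
    qed
  next
    fix a x :: "'b free_word \<Rightarrow>\<^sub>0 'a" assume ax: "a \<in> uea_ideal sc br M \<inter> carrier (free_alg L)" "x \<in> carrier (free_alg L)"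
    show "x \<otimes>\<^bsub>free_alg L\<^esub> a \<in> uea_ideal sc br M \<inter> carrier (free_alg L)"
      using ax F.m_closed[of x a] I.I_l_closed[of a x] m[of x] by (simp add: free_alg_ops)
    show "a \<otimes>\<^bsub>free_alg L\<^esub> x \<in> uea_ideal sc br M \<inter> carrier (free_alg L)"
      using ax F.m_closed[of a x] I.I_r_closed[of a x] m[of x] by (simp add: free_alg_ops)
  qed
  from ring.genideal_minimal[OF ring_free_alg this r] show ?thesis
    by (simp add: uea_ideal_def)
qed

lemma uea_incl_coset:
  assumes "is_lie sc br L" "is_lie sc br M" "L \<subseteq> M" "p \<in> carrier (free_alg L)"
  shows "uea_incl sc br M (uea_ideal sc br L +>\<^bsub>free_alg L\<^esub> p) = uea_ideal sc br M +>\<^bsub>free_alg M\<^esub> p"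
proof -
  interpret I: ideal "uea_ideal sc br M" "free_alg M" by (rule ideal_uea[OF assms(2)])
  have s: "uea_ideal sc br L \<subseteq> uea_ideal sc br M" by (rule uea_ideal_mono[OF assms(1-3)])
  have z: "0 \<in> uea_ideal sc br L" "0 \<in> uea_ideal sc br M"
    using additive_subgroup.zero_closed[OF ideal.axioms(1)[OF ideal_uea[OF assms(1)]]]
      additive_subgroup.zero_closed[OF ideal.axioms(1)[OF ideal_uea[OF assms(2)]]]
    by (simp_all add: free_alg_ops)
  have "a + b \<in> uea_ideal sc br M" if "a \<in> uea_ideal sc br M" "b \<in> uea_ideal sc br L" for a b
    using additive_subgroup.a_closed[OF I.additive_subgroup_axioms, of a b] that s by (auto simp: free_alg_ops)
  note ab = this
  show ?thesis
  proof (rule subset_antisym; rule subsetI)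
    fix v assume "v \<in> uea_incl sc br M (uea_ideal sc br L +>\<^bsub>free_alg L\<^esub> p)"
    then obtain a b where "a \<in> uea_ideal sc br M" "b \<in> uea_ideal sc br L" "v = a + (b + p)"
      by (auto simp: uea_incl_def set_add_def' a_r_coset_def' free_alg_ops)
    then show "v \<in> uea_ideal sc br M +>\<^bsub>free_alg M\<^esub> p"
      using ab[of a b] by (auto simp: a_r_coset_def' free_alg_ops intro!: bexI[of _ "a + b"] simp flip: add.assoc)
  next
    fix v assume "v \<in> uea_ideal sc br M +>\<^bsub>free_alg M\<^esub> p"
    then obtain a where a: "a \<in> uea_ideal sc br M" "v = a + (0 + p)"
      by (auto simp: a_r_coset_def' free_alg_ops)
    then show "v \<in> uea_incl sc br M (uea_ideal sc br L +>\<^bsub>free_alg L\<^esub> p)"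
      using z(1) unfolding uea_incl_def set_add_def' a_r_coset_def' free_alg_ops by blast
  qed
qed

lemma \<Phi>_U_incl:
  assumes "lie_subalgebra \<gg>" "p \<in> carrier (free_alg \<gg>)"
  shows "\<Phi> (U_incl (uea_ideal smult witt_bracket \<gg> +>\<^bsub>free_alg \<gg>\<^esub> p)) = free_eval skew_const witt_map p"
proof -
  have "is_lie smult witt_bracket \<gg>"
    using assms(1) poly_vs.subspace_add[of \<gg>] poly_vs.subspace_scale[of \<gg>]
    by (simp add: is_lie_def lie_subalgebra_def)
  moreover have "p \<in> carrier (free_alg UNIV)" using assms(2) by (simp add: free_alg_carrier)
  ultimately show ?thesis
    unfolding U_incl_def using assms(2) is_lie_UNIV
    by (simp add: uea_incl_coset[OF _ is_lie_UNIV] \<Phi>_def W.lift_coset[OF is_lie_UNIV witt_map_add witt_map_smult witt_map_bracket])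
qed

lemma ring_U_witt: "lie_subalgebra \<gg> \<Longrightarrow> ring (U_witt \<gg>)"
  by (rule ring_uea) (simp add: is_lie_def lie_subalgebra_def poly_vs.subspace_add poly_vs.subspace_scale)

subsection \<open>The subalgebras \<open>\<bbbk>[y]\<close> and \<open>\<bbbk>[y,t,t\<^sup>-\<^sup>1]\<close> in coordinates\<close>

lemma k_y_eq: "k_y = range (\<lambda>c. skew_monom [:c:] 0)"
proof (rule subset_antisym; rule subsetI)
  fix a :: "'a skew_laurent" assume "a \<in> k_y"
  then show "a \<in> range (\<lambda>c. skew_monom [:c:] 0)"
    unfolding k_y_def
  proof induction
    case (mult a b)
    then show ?case by (auto simp: skew_monom_mult shift_const)
  qed (auto simp: skew_const_def poly_y_def skew_monom_add)
next
  fix a :: "'a skew_laurent" assume "a \<in> range (\<lambda>c. skew_monom [:c:] 0)"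
  then obtain c where a: "a = skew_monom [:c:] 0" by blast
  show "a \<in> k_y" unfolding a
  proof (induction c)
    case 0
    show ?case using subalgebra_gen.const[of 0] by (simp add: k_y_def skew_const_def)
  next
    case (pCons u p)
    have "skew_monom [:pCons u p:] 0 = skew_const u + skew_monom poly_y 0 * skew_monom [:p:] 0"
      by (simp add: skew_const_def skew_monom_mult shift_const poly_y_def skew_monom_add)
    then show ?case using pCons.IH unfolding k_y_def
      by (auto intro!: subalgebra_gen.add subalgebra_gen.const subalgebra_gen.mult intro: subalgebra_gen.incl)
  qed
qed

lemma k_ytt_eq: "k_ytt = {f. \<forall>n. degree (Poly_Mapping.lookup (skew_coeff f) n) = 0}"
proof -
  let ?R = "{f. \<forall>n. degree (Poly_Mapping.lookup (skew_coeff f) n) = 0}"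
  have mono: "skew_monom [:c:] n \<in> k_ytt" for c :: "'a poly" and n
  proof -
    have "skew_monom [:c:] 0 \<in> (k_y :: 'a skew_laurent set)" by (auto simp: k_y_eq)
    then have c: "skew_monom [:c:] 0 \<in> k_ytt"
      unfolding k_y_def k_ytt_def by induction (auto intro: subalgebra_gen.intros)
    have s: "skew_t (int m) \<in> (k_ytt :: 'a skew_laurent set) \<and> skew_t (- int m) \<in> (k_ytt :: 'a skew_laurent set)" for m
    proof (induction m)
      case 0
      have "skew_t 0 = skew_const (1::'a)" by (simp add: skew_t_def skew_const_def one_pCons)
      then show ?case by (auto simp: k_ytt_def intro: subalgebra_gen.intros)
    next
      case (Suc m)
      have "skew_t (int (Suc m)) = skew_t 1 * (skew_t (int m) :: 'a skew_laurent)"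
        "skew_t (- int (Suc m)) = skew_t (-1) * (skew_t (- int m) :: 'a skew_laurent)"
        by (simp_all add: skew_t_def skew_monom_mult shift_1 algebra_simps)
      then show ?case using Suc unfolding k_ytt_def by (auto intro!: subalgebra_gen.mult intro: subalgebra_gen.incl)
    qed
    have "skew_t n \<in> (k_ytt :: 'a skew_laurent set)" by (cases n rule: int_cases2) (use s in auto)
    then have "skew_monom [:c:] 0 * skew_t n \<in> k_ytt"
      using c unfolding k_ytt_def by (intro subalgebra_gen.mult)
    then show ?thesis by (simp add: skew_t_def skew_monom_mult shift_1)
  qed
  show ?thesis
  proof (rule subset_antisym; rule subsetI)
    fix f :: "'a skew_laurent" assume f: "f \<in> ?R"
    let ?p = "skew_coeff f"
    have "f = (\<Sum>n\<in>A. skew_monom (Poly_Mapping.lookup ?p n) n)" if "A = Poly_Mapping.keys ?p" for A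
    proof -
      have *: "skew_coeff (\<Sum>n\<in>B. skew_monom (g n) n) = (\<Sum>n\<in>B. Poly_Mapping.single n (g n))" if "finite B" for B and g :: "int \<Rightarrow> 'a poly poly"
        using that by induction (simp_all add: zero_skew_laurent.rep_eq plus_skew_laurent.rep_eq skew_monom.rep_eq)
      have "?p = (\<Sum>n\<in>A. Poly_Mapping.single n (Poly_Mapping.lookup ?p n))"
        by (rule poly_mapping_eqI) (auto simp: that lookup_sum lookup_single when_def in_keys_iff)
      also have "\<dots> = skew_coeff (\<Sum>n\<in>A. skew_monom (Poly_Mapping.lookup ?p n) n)"
        using * that by simp
      finally show ?thesis by (simp add: skew_coeff_inject)
    qed
    moreover have "(\<Sum>n\<in>A. skew_monom (Poly_Mapping.lookup ?p n) n) \<in> k_ytt" if "finite A" for A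
      using that
    proof induction
      case empty
      show ?case using mono[of 0 0] by (simp add: skew_monom_def zero_skew_laurent_def)
    next
      case (insert n A)
      obtain c where "Poly_Mapping.lookup ?p n = [:c:]" using f degree_0_id[of "Poly_Mapping.lookup ?p n"] by (metis (mono_tags, lifting) mem_Collect_eq)
      then have "skew_monom (Poly_Mapping.lookup ?p n) n \<in> k_ytt" using mono by metis
      then show ?case using insert unfolding k_ytt_def by (simp add: subalgebra_gen.add)
    qed
    ultimately show "f \<in> k_ytt" by (metis finite_keys)
  next
    fix f :: "'a skew_laurent" assume "f \<in> k_ytt"
    then show "f \<in> ?R" unfolding k_ytt_def
    proof induction
      case (add a b)
      then show ?case by (auto simp: plus_skew_laurent.rep_eq lookup_add) (metis degree_add_le le_0_eq)
    next
      case (mult a b)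
      show ?case
      proof (rule CollectI, rule allI)
        fix k
        have "degree (Poly_Mapping.lookup (skew_coeff (a * b)) k) \<le> 0"
          unfolding times_skew_laurent.rep_eq skew_mult_def lookup_sum
        proof (intro degree_sum_le finite_keys)
          fix m n
          obtain c d where "Poly_Mapping.lookup (skew_coeff a) m = [:c:]" "Poly_Mapping.lookup (skew_coeff b) n = [:d:]"
            using mult.IH by (metis (mono_tags, lifting) degree_0_id mem_Collect_eq)
          then show "degree (Poly_Mapping.lookup (Poly_Mapping.single (m + n) (Poly_Mapping.lookup (skew_coeff a) m * shift m (Poly_Mapping.lookup (skew_coeff b) n))) k) \<le> 0"
            by (simp add: lookup_single when_def shift_const)
        qed
        then show "degree (Poly_Mapping.lookup (skew_coeff (a * b)) k) = 0" by simp
      qed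
    qed (auto simp: skew_const_def skew_t_def skew_monom.rep_eq lookup_single when_def poly_y_def)
  qed
qed

end

theory Submission
  imports Defs "HOL-Library.Function_Algebras"
begin

text \<open>
  The argument exhibits a left ideal that is not finitely generated. Write elements of \<open>T\<close> with
  coefficients in \<open>\<bbbk>[x,y]\<close> on the left of the powers of \<open>t\<close>, and let \<open>B\<close> be the image of \<open>U(\<gg>)\<close>
  under \<open>\<Phi>\<close>. Every generator \<open>e\<^sub>n\<close> goes to \<open>-(x + ny)t\<^sup>n\<close>, whose coefficient vanishes at
  \<open>x = y = 0\<close>. Therefore \<open>\<Phi>(f\<partial>)T \<subseteq> xT + yT\<close>, and \<open>B\<close> acts from the left on \<open>T/(xT + yT)\<close> by
  scalars only, through the augmentation of \<open>U(\<gg>)\<close>. Consequently a finitely generated left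
  submodule of \<open>T\<close> over \<open>B\<close> has finite-dimensional image in this quotient; since \<open>y\<close> is central,
  the same holds after division by a power of \<open>y\<close>.

  Condition \<open>(*)\<close> produces a submodule with a large image. In \<open>T\<close> the commutator of
  \<open>\<Phi>(f\<partial>)\<close> with an element \<open>p\<close> of \<open>\<bbbk>[y,t,t\<^sup>-\<^sup>1]\<close> is \<open>f p'\<close>, where \<open>p'\<close> is the derivative of \<open>p\<close>
  with respect to \<open>t\<close>. Take \<open>p = \<Phi>(q)\<close> from the condition. In characteristic \<open>0\<close> we have \<open>p' \<noteq> 0\<close>
  because \<open>p \<notin> \<bbbk>[y]\<close>. Let \<open>y\<^sup>h\<close> be the highest power of \<open>y\<close> that divides \<open>p'\<close>, and let \<open>W \<noteq> 0\<close> be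
  the value of \<open>p'/y\<^sup>h\<close> at \<open>y = 0\<close>, a Laurent polynomial in \<open>t\<close>. The elements \<open>f p'\<close> with \<open>f\<partial> \<in> \<gg>\<close>
  belong to \<open>B \<inter> y\<^sup>hT\<close>, and after division by \<open>y\<^sup>h\<close> their images in \<open>T/(xT + yT)\<close> are the Laurent
  polynomials \<open>f W\<close>. They span a space isomorphic to \<open>\<gg>\<close>, which is infinite-dimensional, and so the
  left ideal of all \<open>u \<in> U(\<gg>)\<close> with \<open>\<Phi>(u) \<in> y\<^sup>hT\<close> is not finitely generated.

  The criterion is \<open>left_noetherian_finite_span\<close>, the scalar action is
  \<open>corner_free_eval_mult\<close>, and the injectivity of \<open>f \<mapsto> f W\<close> is \<open>corner_commutator_nonzero\<close>.
\<close>

section \<open>Modules with scalar action over left noetherian rings\<close>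

text \<open>If a left ideal \<open>I\<close> has an additive map to a vector space on which ring elements act as
  scalars, then every linear subspace of the target has a preimage in \<open>I\<close> that is again a left
  ideal. The preimage of the span of the images of finitely many generators contains those
  generators, and so it is all of \<open>I\<close>.\<close>

lemma (in vector_space) left_noetherian_finite_span:
  assumes "ring R" and noeth: "left_noetherian R" and I: "left_ideal I R"
    and add: "\<And>a b. a \<in> I \<Longrightarrow> b \<in> I \<Longrightarrow> \<Gamma> (a \<oplus>\<^bsub>R\<^esub> b) = \<Gamma> a + \<Gamma> b"
    and scal: "\<And>r. r \<in> carrier R \<Longrightarrow> \<exists>c. \<forall>a\<in>I. \<Gamma> (r \<otimes>\<^bsub>R\<^esub> a) = c *s \<Gamma> a"
  shows "\<exists>B. finite B \<and> \<Gamma> ` I \<subseteq> span B"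
proof -
  interpret R: ring R by fact
  have sub: "additive_subgroup I R" and mult: "\<And>a r. a \<in> I \<Longrightarrow> r \<in> carrier R \<Longrightarrow> r \<otimes>\<^bsub>R\<^esub> a \<in> I"
    using I by (auto simp: left_ideal_def)
  interpret S: additive_subgroup I R by fact
  obtain A where A: "finite A" "I = \<Inter>{J. left_ideal J R \<and> A \<subseteq> J}"
    using noeth I unfolding left_noetherian_def by blast
  define J where "J = {a \<in> I. \<Gamma> a \<in> span (\<Gamma> ` A)}"
  have "left_ideal J R"
    unfolding left_ideal_def
  proof (intro conjI ballI)
    have minus: "\<ominus>\<^bsub>R\<^esub> a = (\<ominus>\<^bsub>R\<^esub> \<one>\<^bsub>R\<^esub>) \<otimes>\<^bsub>R\<^esub> a" if "a \<in> I" for a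
      using S.a_Hcarr[OF that] by (simp add: R.l_minus)
    have mJ: "r \<otimes>\<^bsub>R\<^esub> a \<in> J" if a: "a \<in> J" "r \<in> carrier R" for a r
    proof -
      obtain c where "\<Gamma> (r \<otimes>\<^bsub>R\<^esub> a) = c *s \<Gamma> a" using scal[OF a(2)] a(1) by (auto simp: J_def)
      then show ?thesis using a mult span_scale[of "\<Gamma> a" "\<Gamma> ` A" c] by (auto simp: J_def)
    qed
    then show "\<And>a r. a \<in> J \<Longrightarrow> r \<in> carrier R \<Longrightarrow> r \<otimes>\<^bsub>R\<^esub> a \<in> J" .
    show "additive_subgroup J R"
    proof (rule additive_subgroup.intro, rule subgroup.intro, goal_cases)
      case 1
      show ?case using S.a_subset by (auto simp: J_def)
    next
      case (2 a b)
      then show ?case using S.a_closed by (auto simp: J_def add span_add)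
    next
      case 3
      have "\<Gamma> \<zero>\<^bsub>R\<^esub> = \<Gamma> \<zero>\<^bsub>R\<^esub> + \<Gamma> \<zero>\<^bsub>R\<^esub>"
        using add[OF S.zero_closed S.zero_closed] by simp
      then show ?case using S.zero_closed span_zero by (simp add: J_def)
    next
      case (4 a)
      have "\<ominus>\<^bsub>R\<^esub> a \<in> J" using mJ[of a "\<ominus>\<^bsub>R\<^esub> \<one>\<^bsub>R\<^esub>"] minus[of a] 4 by (simp add: J_def)
      then show ?case by (simp add: a_inv_def)
    qed
  qed
  moreover have "A \<subseteq> J" unfolding J_def using A(2) by (auto intro: span_base)
  ultimately have "I \<subseteq> J" using A(2) by blast
  then show ?thesis using A(1) by (intro exI[of _ "\<Gamma> ` A"]) (auto simp: J_def)
qed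

section \<open>Coefficients in the skew Laurent ring\<close>

definition t_coeff :: "'k::field skew_laurent \<Rightarrow> int \<Rightarrow> 'k poly poly" where
  "t_coeff z = Poly_Mapping.lookup (skew_coeff z)"

lemma t_coeff_add: "t_coeff (a + b) n = t_coeff a n + t_coeff b n"
  by (simp add: t_coeff_def plus_skew_laurent.rep_eq lookup_add)

lemma t_coeff_diff: "t_coeff (a - b) n = t_coeff a n - t_coeff b n"
  by (simp add: t_coeff_def minus_skew_laurent.rep_eq lookup_minus)

lemma t_coeff_zero: "t_coeff 0 n = 0"
  by (simp add: t_coeff_def zero_skew_laurent.rep_eq)

lemma t_coeff_sum: "t_coeff (\<Sum>i\<in>A. g i) n = (\<Sum>i\<in>A. t_coeff (g i) n)"
  by (induction A rule: infinite_finite_induct) (simp_all add: t_coeff_zero t_coeff_add)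

lemma t_coeff_monom: "t_coeff (skew_monom a m) n = (if n = m then a else 0)"
  by (simp add: t_coeff_def skew_monom.rep_eq lookup_single when_def)

lemma skew_eqI: "(\<And>n. t_coeff a n = t_coeff b n) \<Longrightarrow> a = b"
  by (metis t_coeff_def poly_mapping_eqI skew_coeff_inject)

lemma t_coeff_monom_mult: "t_coeff (skew_monom b k * z) m = b * shift k (t_coeff z (m - k))"
  by (induction z rule: skew_induct)
     (auto simp: skew_monom_mult t_coeff_monom shift_0 distrib_left t_coeff_add shift_add)

lemma t_coeff_mult_monom: "t_coeff (z * skew_monom b k) m = t_coeff z (m - k) * shift (m - k) b"
  by (induction z rule: skew_induct)
     (auto simp: skew_monom_mult t_coeff_monom distrib_right t_coeff_add)

lemma t_coeff_const_mult: "t_coeff (skew_const c * z) m = [:[:c:]:] * t_coeff z m"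
  by (simp add: skew_const_def t_coeff_monom_mult shift_zero_left)

definition skew_y :: "nat \<Rightarrow> 'k::field skew_laurent" where
  "skew_y h = skew_monom [:monom 1 h:] 0"

lemma t_coeff_skew_y_mult: "t_coeff (skew_y h * z) m = [:monom 1 h:] * t_coeff z m"
  by (simp add: skew_y_def t_coeff_monom_mult shift_zero_left)

lemma skew_y_central: "skew_y h * z = z * skew_y h"
proof (rule skew_eqI)
  fix n
  have "t_coeff (z * skew_y h) n = t_coeff z n * [:monom 1 h:]"
    by (simp add: skew_y_def t_coeff_mult_monom shift_const)
  then show "t_coeff (skew_y h * z) n = t_coeff (z * skew_y h) n"
    by (simp add: t_coeff_skew_y_mult)
qed

lemma skew_y_left_commute: "a * (skew_y h * z) = skew_y h * (a * z)"
  by (metis mult.assoc skew_y_central)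

text \<open>An element all of whose coefficients are divisible by \<open>y\<^sup>h\<close> is itself a multiple of
  \<open>y\<^sup>h\<close>, because coefficients are written on the left and \<open>y\<close> commutes with \<open>t\<close>.\<close>

lemma skew_y_dvdI:
  assumes "\<And>n. [:monom 1 h:] dvd t_coeff z n"
  shows "z \<in> range ((*) (skew_y h))"
proof
  define y where "y = ([:monom 1 h:] :: 'a poly poly)"
  let ?z = "Abs_skew (Poly_Mapping.map (\<lambda>a. a div y) (skew_coeff z))"
  have "t_coeff ?z n = t_coeff z n div y" for n
    by (simp add: t_coeff_def Abs_skew_inverse Poly_Mapping.map.rep_eq when_def)
  then show "z = skew_y h * ?z"
    using assms by (intro skew_eqI)
      (simp only: t_coeff_skew_y_mult dvd_mult_div_cancel flip: y_def)
qed simp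

section \<open>The constant term at \<open>x = y = 0\<close>\<close>

text \<open>For \<open>z = y\<^sup>h z'\<close> the function \<open>corner h z\<close> is the image of \<open>z'\<close> in \<open>T/(xT + yT)\<close>, a Laurent
  polynomial in \<open>t\<close> given by its coefficients. Reading it off as the coefficient of \<open>x\<^sup>0 y\<^sup>h\<close> in \<open>z\<close>
  avoids the choice of a quotient \<open>z'\<close> and is additive on all of \<open>T\<close>.\<close>

definition corner :: "nat \<Rightarrow> 'k::field skew_laurent \<Rightarrow> int \<Rightarrow> 'k" where
  "corner h z n = coeff (coeff (t_coeff z n) 0) h"

lemma corner_add: "corner h (a + b) = corner h a + corner h b"
  by (rule ext) (simp add: corner_def t_coeff_add)

lemma corner_const_mult: "corner h (skew_const c * z) = (\<lambda>n. c * corner h z n)"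
  by (rule ext) (simp add: corner_def t_coeff_const_mult)

lemma corner_skew_y_mult: "corner h (skew_y h * z) = corner 0 z"
  by (rule ext) (simp add: corner_def t_coeff_skew_y_mult coeff_mult_0 coeff_monom_mult)

lemma witt_map_eq_sum_monom:
  "witt_map f = (\<Sum>i\<le>degree f. skew_monom
     ([:[:- coeff f i:]:] * (poly_x + of_int (int i - 1) * poly_y)) (int i - 1))"
proof -
  have "skew_const c * skew_monom (- b) k = skew_monom ([:[:- c:]:] * b) k" for c :: 'a and b k
    using smult_minus_left[of "[:c:]" b] by (simp add: skew_const_def skew_monom_mult shift_zero_left)
  then show ?thesis unfolding witt_map_def by (intro sum.cong refl)
qed

lemma corner_witt_map_mult: "corner 0 (witt_map f * z) = 0"
proof (rule ext)
  fix n
  have "coeff (coeff poly_x 0) 0 = (0 :: 'a)" "coeff (coeff poly_y 0) 0 = (0 :: 'a)"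
    by (simp_all add: poly_x_def poly_y_def)
  then show "corner 0 (witt_map f * z) n = 0 n"
    by (simp add: corner_def witt_map_eq_sum_monom sum_distrib_right t_coeff_sum
        t_coeff_monom_mult coeff_sum coeff_mult_0 zero_fun_def)
qed

text \<open>Every word of positive length in the generators begins with a factor that sends \<open>T\<close> into
  \<open>xT + yT\<close>, so only the coefficient of the empty word contributes.\<close>

lemma corner_free_eval_mult:
  "\<exists>c. \<forall>z. corner 0 (free_eval skew_const witt_map p * z) = (\<lambda>n. c * corner 0 z n)"
proof (induction p rule: single_add_induct)
  case (1 w a)
  show ?case
  proof (cases "letters w")
    case Nil
    then show ?thesis by (auto simp: W.single corner_const_mult)
  next
    case (Cons f fs)
    have "corner 0 (free_eval skew_const witt_map (Poly_Mapping.single w a) * z) = (\<lambda>n. 0 * corner 0 z n)" for z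
      by (simp add: W.single Cons mult.assoc corner_const_mult corner_witt_map_mult)
    then show ?thesis by blast
  qed
next
  case (2 p q)
  then obtain c d where
    "\<forall>z. corner 0 (free_eval skew_const witt_map p * z) = (\<lambda>n. c * corner 0 z n)"
    "\<forall>z. corner 0 (free_eval skew_const witt_map q * z) = (\<lambda>n. d * corner 0 z n)" by blast
  then show ?case
    by (intro exI[of _ "c + d"]) (auto simp: W.add distrib_right corner_add)
qed

section \<open>Commutators with elements of \<open>\<bbbk>[y,t,t\<^sup>-\<^sup>1]\<close>\<close>

text \<open>This is the coordinate form of \<open>[f\<partial>, p] = f p'\<close>: moving \<open>t\<^sup>n\<close> past \<open>x\<close> replaces \<open>x\<close> by
  \<open>x + n\<close>, and everything else in the two products cancels.\<close>

lemma t_coeff_commutator_witt_map: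
  assumes "p \<in> k_ytt"
  shows "t_coeff (witt_map f * p - p * witt_map f) m =
    (\<Sum>i\<le>degree f. [:[:coeff f i * of_int (m + 1 - int i):]:] * t_coeff p (m + 1 - int i))"
proof -
  have "t_coeff (witt_map f * p - p * witt_map f) m =
    (\<Sum>i\<le>degree f. [:[:- coeff f i:]:] * (poly_x + of_int (int i - 1) * poly_y)
         * shift (int i - 1) (t_coeff p (m - (int i - 1)))
       - t_coeff p (m - (int i - 1)) * shift (m - (int i - 1))
          ([:[:- coeff f i:]:] * (poly_x + of_int (int i - 1) * poly_y)))"
    by (simp add: witt_map_eq_sum_monom sum_distrib_left sum_distrib_right t_coeff_sum
        t_coeff_diff t_coeff_monom_mult t_coeff_mult_monom sum_subtractf del: of_int_diff)
  also have "\<dots> = (\<Sum>i\<le>degree f. [:[:coeff f i * of_int (m + 1 - int i):]:] * t_coeff p (m + 1 - int i))"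
  proof (intro sum.cong refl)
    fix i
    define k where "k = int i - 1"
    have e: "m + 1 - int i = m - k" "int i - 1 = k" by (simp_all add: k_def)
    obtain c where c: "t_coeff p (m - k) = [:c:]"
      using assms unfolding k_ytt_eq t_coeff_def by (metis (mono_tags, lifting) degree_0_id mem_Collect_eq)
    have o: "shift j (of_int l) = (of_int l :: 'a poly poly)" for j l
      by (simp add: shift_def of_int_poly)
    have poly_id: "- a * (x + l * y) * b - b * (- a * (x + d + l * y)) = a * d * b"
      for a b d l x y :: "'a poly poly"
      by (simp add: algebra_simps)
    have n: "[:[:- a:]:] = - [:[:a:]:]" for a :: 'a by simp
    have s: "[:[:coeff f i * of_int (m - k):]:] = [:[:coeff f i:]:] * (of_int (m - k) :: 'a poly poly)"
      by (simp add: of_int_poly)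
    show "[:[:- coeff f i:]:] * (poly_x + of_int (int i - 1) * poly_y)
         * shift (int i - 1) (t_coeff p (m - (int i - 1)))
       - t_coeff p (m - (int i - 1)) * shift (m - (int i - 1))
          ([:[:- coeff f i:]:] * (poly_x + of_int (int i - 1) * poly_y))
       = [:[:coeff f i * of_int (m + 1 - int i):]:] * t_coeff p (m + 1 - int i)"
      unfolding e c shift_const shift_mult shift_add shift_x shift_y o s
      unfolding n by (rule poly_id)
  qed
  finally show ?thesis .
qed

lemma corner_commutator_witt_map:
  assumes "p \<in> k_ytt"
  shows "corner h (witt_map f * p - p * witt_map f) m =
    (\<Sum>i\<le>degree f. coeff f i * (of_int (m + 1 - int i) * corner h p (m + 1 - int i)))"
  by (simp add: corner_def t_coeff_commutator_witt_map[OF assms] coeff_sum mult.assoc)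

lemma finite_corner_support: "finite {n. corner h z n \<noteq> 0}"
  by (rule finite_subset[of _ "Poly_Mapping.keys (skew_coeff z)"])
     (auto simp: corner_def t_coeff_def in_keys_iff)

text \<open>The corner of \<open>f p'\<close> is the product of \<open>f\<close> with the corner of \<open>p'\<close>, and the
  product of the two leading terms survives.\<close>

lemma corner_commutator_nonzero:
  fixes p :: "'k::field_char_0 skew_laurent"
  assumes p: "p \<in> k_ytt" and n: "n \<noteq> 0" "corner h p n \<noteq> 0" and f: "f \<noteq> 0"
  shows "corner h (witt_map f * p - p * witt_map f) \<noteq> 0"
proof -
  \<comment> \<open>\<open>w n\<close> is the coefficient of \<open>t\<^sup>n\<close> in the Laurent polynomial belonging to \<open>t p'\<close>.\<close>
  define w where "w n = of_int n * corner h p n" for n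
  have fin: "finite {n. w n \<noteq> 0}"
    by (rule finite_subset[OF _ finite_corner_support[of h p]]) (auto simp: w_def)
  have "w n \<noteq> 0" using n by (simp add: w_def)
  define N where "N = Max {n. w n \<noteq> 0}"
  have N: "w N \<noteq> 0" using Max_in[OF fin] \<open>w n \<noteq> 0\<close> unfolding N_def by blast
  have above: "w k = 0" if "k > N" for k
    using Max_ge[OF fin, of k] that unfolding N_def by force
  let ?m = "N + int (degree f) - 1"
  have "corner h (witt_map f * p - p * witt_map f) ?m = (\<Sum>i\<le>degree f. coeff f i * w (?m + 1 - int i))"
    unfolding corner_commutator_witt_map[OF p] w_def ..
  also have "\<dots> = (\<Sum>i\<in>{degree f}. coeff f i * w (?m + 1 - int i))"
    by (rule sum.mono_neutral_right) (auto simp: above)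
  also have "\<dots> \<noteq> 0" using N f by simp
  finally show ?thesis by (auto simp: zero_fun_def)
qed

lemma k_ytt_minus_k_y_ex_corner:
  assumes "p \<in> k_ytt - k_y"
  shows "\<exists>h n. n \<noteq> 0 \<and> corner h p n \<noteq> 0"
proof (rule ccontr)
  assume "\<not> ?thesis"
  then have z: "corner h p n = 0" if "n \<noteq> 0" for h n using that by blast
  have d: "t_coeff p n = [:coeff (t_coeff p n) 0:]" for n
    using assms degree_0_id[of "t_coeff p n"] by (simp add: k_ytt_eq t_coeff_def)
  have "t_coeff p n = 0" if "n \<noteq> 0" for n
  proof -
    have "coeff (t_coeff p n) 0 = 0"
      using z[OF that] by (intro poly_eqI) (simp add: corner_def)
    then show ?thesis using d[of n] by simp
  qed
  then have "p = skew_monom [:coeff (t_coeff p 0) 0:] 0"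
    by (intro skew_eqI) (simp add: t_coeff_monom flip: d)
  then have "p \<in> k_y" by (simp add: k_y_eq) 
  then show False using assms by blast
qed

lemma skew_y_dvd_commutator:
  assumes p: "p \<in> k_ytt" and low: "\<And>j n. j < h \<Longrightarrow> n \<noteq> 0 \<Longrightarrow> corner j p n = 0"
  shows "witt_map f * p - p * witt_map f \<in> range ((*) (skew_y h))"
proof (rule skew_y_dvdI)
  fix m
  have "[:monom 1 h:] dvd [:[:a * of_int n:]:] * t_coeff p n" for a n
  proof (cases "n = 0")
    case False
    have "monom 1 h dvd coeff (t_coeff p n) 0"
      using low[OF _ False] by (simp add: monom_1_dvd_iff' corner_def)
    then obtain d where "[:coeff (t_coeff p n) 0:] = [:monom 1 h:] * [:d:]" by (auto elim: dvdE)
    moreover have "t_coeff p n = [:coeff (t_coeff p n) 0:]"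
      using p degree_0_id[of "t_coeff p n"] by (simp add: k_ytt_eq t_coeff_def)
    ultimately have "[:monom 1 h:] dvd t_coeff p n"
      by (metis dvd_triv_left)
    then show ?thesis by (rule dvd_mult)
  qed simp
  then show "[:monom 1 h:] dvd t_coeff (witt_map f * p - p * witt_map f) m"
    unfolding t_coeff_commutator_witt_map[OF p] by (intro dvd_sum)
qed

section \<open>A left ideal that is not finitely generated\<close>

theorem theorem5p9:
  fixes \<gg> :: "'k::field_char_0 poly set"
  assumes "lie_subalgebra \<gg>"
    and "infinite_dimensional \<gg>"
    and "condition_star \<gg>"
  shows "\<not> noetherian (U_witt \<gg>)"
proof
  let ?scale = "\<lambda>c (v :: int \<Rightarrow> 'k) n. c * v n"
  interpret E: vector_space ?scale
    by standard (auto simp: algebra_simps)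
  interpret PE: vector_space_pair smult ?scale ..
  assume noeth: "noetherian (U_witt \<gg>)"
  have lie: "is_lie smult witt_bracket \<gg>"
    using assms(1) by (simp add: is_lie_def lie_subalgebra_def poly_vs.subspace_add poly_vs.subspace_scale)
  let ?coset = "\<lambda>p. uea_ideal smult witt_bracket \<gg> +>\<^bsub>free_alg \<gg>\<^esub> p"
  \<comment> \<open>\<open>\<Psi>\<close> is the restriction of \<open>\<Phi>\<close> to \<open>U(\<gg>)\<close>, obtained directly from the universal property of
    \<open>U(\<gg>)\<close>.\<close>
  define \<Psi> where "\<Psi> = uea_lift skew_const (witt_map :: 'k poly \<Rightarrow> _)"
  have \<Psi>_coset: "\<Psi> (?coset p) = free_eval skew_const witt_map p" if "p \<in> carrier (free_alg \<gg>)" for p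
    unfolding \<Psi>_def using that
    by (intro W.lift_coset lie witt_map_add witt_map_smult witt_map_bracket)
  have hom: "\<Psi> \<in> ring_hom (U_witt \<gg>) (class_ring UNIV)"
    unfolding \<Psi>_def by (intro W.lift_hom lie witt_map_add witt_map_smult witt_map_bracket)
  have coset_ex: "\<exists>p\<in>carrier (free_alg \<gg>). u = ?coset p" if "u \<in> carrier (U_witt \<gg>)" for u
    using that by (auto simp: uea_def FactRing_def A_RCOSETS_def')
  have coset_closed: "?coset p \<in> carrier (U_witt \<gg>)" if "p \<in> carrier (free_alg \<gg>)" for p
    using that by (auto simp: uea_def FactRing_def A_RCOSETS_def')
  interpret U: ring "U_witt \<gg>" by (rule ring_U_witt[OF assms(1)])
  have \<Psi>_add: "\<Psi> (u \<oplus>\<^bsub>U_witt \<gg>\<^esub> v) = \<Psi> u + \<Psi> v"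
    and \<Psi>_mult: "\<Psi> (u \<otimes>\<^bsub>U_witt \<gg>\<^esub> v) = \<Psi> u * \<Psi> v"
    if "u \<in> carrier (U_witt \<gg>)" "v \<in> carrier (U_witt \<gg>)" for u v
    using ring_hom_add[OF hom that] ring_hom_mult[OF hom that] by simp_all

  obtain q where q: "q \<in> carrier (free_alg \<gg>)" "free_eval skew_const witt_map q \<in> k_ytt - k_y"
    using assms(3) coset_ex \<Phi>_U_incl[OF assms(1)] unfolding condition_star_def by metis
  define p where "p = free_eval skew_const witt_map q"
  have p: "p \<in> k_ytt" "p \<in> k_ytt - k_y" using q(2) by (auto simp: p_def)
  \<comment> \<open>The terms with \<open>n = 0\<close> lie in \<open>\<bbbk>[y]\<close> and do not affect \<open>p'\<close>; hence \<open>y\<^sup>h\<close> is the exact power of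
    \<open>y\<close> in \<open>p'\<close>.\<close>
  define h where "h = (LEAST h. \<exists>n. n \<noteq> 0 \<and> corner h p n \<noteq> 0)"
  obtain n where n: "n \<noteq> 0" "corner h p n \<noteq> 0"
    using LeastI_ex[OF k_ytt_minus_k_y_ex_corner[OF p(2)]] unfolding h_def by blast
  have low: "corner j p n = 0" if "j < h" "n \<noteq> 0" for j n
    using not_less_Least[OF that(1)[unfolded h_def]] that(2) by blast

  define I where "I = {u \<in> carrier (U_witt \<gg>). \<Psi> u \<in> range ((*) (skew_y h))}"
  have mult: "r \<otimes>\<^bsub>U_witt \<gg>\<^esub> u \<in> I"
    if u: "u \<in> I" and r: "r \<in> carrier (U_witt \<gg>)" for u r
  proof -
    obtain z where "\<Psi> u = skew_y h * z" using u by (auto simp: I_def)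
    then have "\<Psi> (r \<otimes>\<^bsub>U_witt \<gg>\<^esub> u) = skew_y h * (\<Psi> r * z)"
      using u r by (simp add: I_def \<Psi>_mult skew_y_left_commute)
    then show ?thesis using u r by (auto simp: I_def)
  qed
  have ideal: "left_ideal I (U_witt \<gg>)"
    unfolding left_ideal_def
  proof (intro conjI ballI mult)
    show "additive_subgroup I (U_witt \<gg>)"
    proof (rule additive_subgroup.intro, rule subgroup.intro, goal_cases)
      case 1
      show ?case by (auto simp: I_def)
    next
      case (2 a b)
      then show ?case by (auto simp: I_def \<Psi>_add simp flip: distrib_left)
    next
      case 3
      have "\<Psi> \<zero>\<^bsub>U_witt \<gg>\<^esub> = skew_y h * 0" using \<Psi>_add[OF U.zero_closed U.zero_closed] by simp
      then have "\<Psi> \<zero>\<^bsub>U_witt \<gg>\<^esub> \<in> range ((*) (skew_y h))" by blast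
      then show ?case by (simp add: I_def)
    next
      case (4 a)
      then have a: "a \<in> I" "a \<in> carrier (U_witt \<gg>)" by (auto simp: I_def)
      have "\<ominus>\<^bsub>U_witt \<gg>\<^esub> a \<in> I"
        using mult[OF a(1), of "\<ominus>\<^bsub>U_witt \<gg>\<^esub> \<one>\<^bsub>U_witt \<gg>\<^esub>"] a(2) by (simp add: U.l_minus)
      then show ?case by (simp add: a_inv_def)
    qed
  qed auto
  have "\<exists>B. finite B \<and> (\<lambda>u. corner h (\<Psi> u)) ` I \<subseteq> E.span B"
  proof (rule E.left_noetherian_finite_span[OF U.ring_axioms _ ideal])
    show "left_noetherian (U_witt \<gg>)" using noeth by (simp add: noetherian_def)
    show "corner h (\<Psi> (a \<oplus>\<^bsub>U_witt \<gg>\<^esub> b)) = corner h (\<Psi> a) + corner h (\<Psi> b)"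
      if "a \<in> I" "b \<in> I" for a b
      using that by (simp add: I_def \<Psi>_add corner_add)
    show "\<exists>c. \<forall>u\<in>I. corner h (\<Psi> (r \<otimes>\<^bsub>U_witt \<gg>\<^esub> u)) = (\<lambda>n. c * corner h (\<Psi> u) n)"
      if r: "r \<in> carrier (U_witt \<gg>)" for r
    proof -
      obtain s where s: "s \<in> carrier (free_alg \<gg>)" "r = ?coset s" using coset_ex[OF r] by blast
      obtain c where c: "\<And>z. corner 0 (\<Psi> r * z) = (\<lambda>n. c * corner 0 z n)"
        using corner_free_eval_mult[of s] \<Psi>_coset[OF s(1)] s(2) by auto
      have "corner h (\<Psi> (r \<otimes>\<^bsub>U_witt \<gg>\<^esub> u)) = (\<lambda>n. c * corner h (\<Psi> u) n)" if u: "u \<in> I" for u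
      proof -
        obtain z where z: "\<Psi> u = skew_y h * z" using u by (auto simp: I_def)
        have "\<Psi> (r \<otimes>\<^bsub>U_witt \<gg>\<^esub> u) = skew_y h * (\<Psi> r * z)"
          using u r z by (simp add: I_def \<Psi>_mult skew_y_left_commute)
        then show ?thesis by (simp add: z corner_skew_y_mult c)
      qed
      then show ?thesis by blast
    qed
  qed
  then obtain B where B: "finite B" "(\<lambda>u. corner h (\<Psi> u)) ` I \<subseteq> E.span B" by blast

  define L where "L f = corner h (witt_map f * p - p * witt_map f)" for f
  have L_span: "L f \<in> E.span B" if f: "f \<in> \<gg>" for f
  proof -
    \<comment> \<open>The lift of \<open>f p'\<close> to \<open>U(\<gg>)\<close> is the commutator of \<open>f\<partial>\<close> with \<open>q\<close>.\<close>
    let ?c = "free_gen f * q - q * free_gen f"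
    have c: "?c \<in> carrier (free_alg \<gg>)"
      using f q(1) by (intro free_alg_minus free_alg_mult free_gen_closed)
    have \<Psi>c: "\<Psi> (?coset ?c) = witt_map f * p - p * witt_map f"
      unfolding \<Psi>_coset[OF c] by (simp add: W.minus W.mult W.gen p_def)
    then have "?coset ?c \<in> I"
      using skew_y_dvd_commutator[OF p(1) low] coset_closed[OF c] by (simp add: I_def)
    then show ?thesis using B(2) \<Psi>c unfolding L_def by force
  qed
  have lin: "Vector_Spaces.linear smult ?scale L"
  proof
    show "L (f + g) = L f + L g" for f g
      unfolding L_def by (simp add: witt_map_add algebra_simps flip: corner_add)
    show "L (smult c f) = (\<lambda>n. c * L f n)" for c f
    proof -
      have "p * (skew_const c * witt_map f) = skew_const c * (p * witt_map f)"
        by (metis mult.assoc skew_const_central)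
      then show ?thesis
        unfolding L_def by (simp add: witt_map_smult mult.assoc flip: corner_const_mult right_diff_distrib)
    qed
  qed
  have inj: "inj L"
    using corner_commutator_nonzero[OF p(1) n] unfolding PE.linear_inj_iff_eq_0[OF lin] L_def by blast
  obtain X where X: "X \<subseteq> \<gg>" "\<not> poly_vs.dependent X" "\<gg> \<subseteq> poly_vs.span X"
    using poly_vs.maximal_independent_subset[of \<gg>] by blast
  have "\<not> E.dependent (L ` X)"
    using PE.linear_independent_injective_image[OF lin X(2)] inj by (auto intro: inj_on_subset)
  moreover have "L ` X \<subseteq> E.span B" using L_span X(1) by blast
  ultimately have "finite (L ` X)" using E.independent_span_bound[OF B(1)] by blast
  then have "finite X" using finite_imageD[OF _ inj_on_subset[OF inj]] by blast
  then show False using X(3) assms(2) unfolding infinite_dimensional_def by blast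
qed

end
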